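(* Let $b=(b_1,b_2)\in\operatorname{int}(\operatorname{conv}\{(0,-1),(0,-1/2),(-1,-1)\})$ (equivalently, $-1<b_2<b_1<0$ and $b_1-2b_2>1$), so that $T(b)$ is a mixing set Type 3 triangle, and let $S=\mathbb{Z}^2+b$. Put $\delta_b:=-b_1^2-b_2^2+b_1b_2-b_2$ (which is positive) and $$P(b):=\Big\{(x_1,x_2,x_3)\in\mathbb{R}^2\times\mathbb{R}_+:\ \tfrac{-b_1}{\delta_b}x_1+\tfrac{b_1-b_2}{\delta_b}x_2-\tfrac{b_1-b_2}{\delta_b}x_3\le1,\ \ \tfrac{-b_1-1}{\delta_b}x_1+\tfrac{b_1-b_2}{\delta_b}x_2\le1,\ \ \tfrac{-b_1}{\delta_b}x_1+\tfrac{b_1-b_2-1}{\delta_b}x_2+\tfrac{2-b_1+2b_2}{2\delta_b}x_3\le1\Big\}.$$ Then $P(b)$ is $(S\times\mathbb{Z})$-free, i.e. $\operatorname{int}(P(b))\cap(S\times\mathbb{Z})=\emptyset$.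
   Context: $\mathbb{R}_+$ denotes the nonnegative reals. The triangle $T(b)$ is $$T(b)=\Big\{(x_1,x_2)\in\mathbb{R}^2:\ \tfrac{-b_1}{\delta_b}x_1+\tfrac{b_1-b_2}{\delta_b}x_2\le1,\ \ \tfrac{-b_1-1}{\delta_b}x_1+\tfrac{b_1-b_2}{\delta_b}x_2\le1,\ \ \tfrac{-b_1}{\delta_b}x_1+\tfrac{b_1-b_2-1}{\delta_b}x_2\le1\Big\};$$ it is called a mixing set Type 3 triangle when $b$ satisfies the stated condition. One has $P(b)\cap\{x_3=0\}=T(b)\times\{0\}$. *)

theory Defs
  imports "HOL-Analysis.Analysis"
begin

definition shifted_lattice :: "real \<times> real \<Rightarrow> (real \<times> real) set" where
  "shifted_lattice b = (\<lambda>z. z + b) ` (\<int> \<times> \<int>)"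

definition delta :: "real \<times> real \<Rightarrow> real" where
  "delta = (\<lambda>(b1, b2). - (b1\<^sup>2) - b2\<^sup>2 + b1 * b2 - b2)"

definition T :: "real \<times> real \<Rightarrow> (real \<times> real) set" where
  "T = (\<lambda>(b1, b2). let d = delta (b1, b2) in
     {(x1, x2).
        (- b1) / d * x1 + (b1 - b2) / d * x2 \<le> 1 \<and>
        (- b1 - 1) / d * x1 + (b1 - b2) / d * x2 \<le> 1 \<and>
        (- b1) / d * x1 + (b1 - b2 - 1) / d * x2 \<le> 1})"

text \<open>Three-dimensional space is represented as \<open>(real \<times> real) \<times> real\<close>, so that the product of
  a planar set with a set of reals is again a set of this type. The condition \<open>0 \<le> x3\<close> expresses
  that the third coordinate ranges over the nonnegative reals; interiors are taken in the full
  three-dimensional space.\<close>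

definition P :: "real \<times> real \<Rightarrow> ((real \<times> real) \<times> real) set" where
  "P = (\<lambda>(b1, b2). let d = delta (b1, b2) in
     {((x1, x2), x3). 0 \<le> x3 \<and>
        (- b1) / d * x1 + (b1 - b2) / d * x2 - (b1 - b2) / d * x3 \<le> 1 \<and>
        (- b1 - 1) / d * x1 + (b1 - b2) / d * x2 \<le> 1 \<and>
        (- b1) / d * x1 + (b1 - b2 - 1) / d * x2 + (2 - b1 + 2 * b2) / (2 * d) * x3 \<le> 1})"

definition set_free :: "'a::topological_space set \<Rightarrow> 'a set \<Rightarrow> bool" where
  "set_free X K \<longleftrightarrow> interior K \<inter> X = {}"

text \<open>For parameters in the following region, \<open>T b\<close> is called a mixing set Type 3 triangle.\<close>

lemma type3_params_iff:
  fixes b1 b2 :: real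
  shows "(b1, b2) \<in> interior (convex hull {(0, -1), (0, -1/2), (-1, -1)}) \<longleftrightarrow>
    -1 < b2 \<and> b2 < b1 \<and> b1 < 0 \<and> b1 - 2 * b2 > 1"
proof -
  have nc: "\<not> collinear {(0, -1), (0, -1/2), (-1, -1) :: real \<times> real}"
    by (auto simp: collinear_3_expand)
  have "(b1, b2) \<in> interior (convex hull {(0, -1), (0, -1/2), (-1, -1)}) \<longleftrightarrow>
      (\<exists>x y z. 0 < x \<and> 0 < y \<and> 0 < z \<and> x + y + z = 1 \<and>
      - z = b1 \<and> - x - y / 2 - z = b2)"
    by (subst interior_convex_hull_3_minimal[OF nc]) auto
  also have "\<dots> \<longleftrightarrow> -1 < b2 \<and> b2 < b1 \<and> b1 < 0 \<and> b1 - 2 * b2 > 1" (is "?L \<longleftrightarrow> ?R")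
  proof
    assume ?L
    then obtain x y z where "0 < x" "0 < y" "0 < z" "x + y + z = 1" "- z = b1" "- x - y / 2 - z = b2"
      by blast
    then show ?R by (intro conjI; linarith)
  next
    assume ?R
    then show ?L
      by (intro exI[of _ "b1 - 2 * b2 - 1"] exI[of _ "2 * b2 + 2"] exI[of _ "- b1"])
        (auto simp: field_simps)
  qed
  finally show ?thesis .
qed

lemma delta_pos:
  assumes "b \<in> interior (convex hull {(0, -1), (0, -1/2), (-1, -1)})"
  shows "0 < delta b"
proof -
  obtain b1 b2 where b: "b = (b1, b2)" by fastforce
  have r: "-1 < b2" "b2 < b1" "b1 < 0" using assms unfolding b type3_params_iff by auto
  have "0 < (- b2) * (1 + b2)" "0 < (- b1) * (b1 - b2)"
    using r by (simp_all add: mult_neg_pos)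
  then show ?thesis
    by (simp add: b delta_def power2_eq_square algebra_simps)
qed

lemma P_slice: "P b \<inter> {x. snd x = 0} = T b \<times> {0}"
  by (cases b) (auto simp: P_def T_def Let_def)

end

theory Submission
  imports Defs
begin

text \<open>Write a lattice point of height \<open>k\<close> as \<open>(m + b\<^sub>1, n + b\<^sub>2, k)\<close> and put \<open>p = - b\<^sub>1\<close>,
  \<open>c = 1 - b\<^sub>1 + b\<^sub>2\<close> and \<open>j = n - k\<close>. In the interior all four inequalities
  are strict, so \<open>k \<ge> 1\<close>; after clearing \<open>\<delta>\<^sub>b\<close> the other three become
  \<open>p (m - 1) + (1 - c) (j - 1) < 0\<close>, \<open>(1 - c) (j + k - 1) < (1 - p) m\<close> and
  \<open>p (m - k / 2) < c j\<close>, where \<open>0 < p < c < (1 + p) / 2\<close>. For \<open>j \<ge> 1\<close> the first two bound \<open>m\<close> from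
  opposite sides. For \<open>j \<le> 0\<close> the third, as \<open>p < c\<close>, gives \<open>k \<ge> 2 m - 2 j + 1\<close> by integrality, and this
  contradicts the second.\<close>

lemma no_integer_solution:
  fixes p c :: real and m j k :: int
  assumes p: "0 < p" "p < c" and c: "2 * c < 1 + p" and k: "1 \<le> k"
    and e1: "p * (of_int m - 1) + (1 - c) * (of_int j - 1) < 0"
    and e2: "(1 - c) * (of_int j + of_int k - 1) < (1 - p) * of_int m"
    and e3: "p * (of_int m - of_int k / 2) < c * of_int j"
  shows False
proof -
  have c1: "c < 1" and p1: "p < 1" using p c by auto
  show False
  proof (cases "1 \<le> j")
    case True
    then have "0 \<le> (1 - c) * (of_int j - 1)" using c1 by simp
    then have "p * (of_int m - 1) < 0" using e1 by linarith
    then have "m \<le> 0" using p by (simp add: mult_less_0_iff)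
    then have "(1 - p) * m \<le> 0" using p1 by (simp add: mult_nonneg_nonpos)
    moreover have "0 \<le> (1 - c) * (of_int j + of_int k - 1)" using c1 True k by simp
    ultimately show False using e2 by linarith
  next
    case False
    then have "c * j \<le> p * j" using p by (simp add: mult_right_mono_neg)
    then have "p * (of_int m - of_int k / 2) < p * j" using e3 by linarith
    then have "of_int m - of_int k / 2 < (of_int j :: real)" using p by simp
    then have k2: "2 * m - 2 * j + 1 \<le> k" by linarith
    show False
    proof (cases "1 \<le> m")
      case True
      \<comment> \<open>For positive \<open>m\<close>, the hypothesis \<open>2 * c < 1 + p\<close>,
        that is \<open>1 - p < 2 * (1 - c)\<close>, doubles the coefficient of \<open>m\<close>. The
        bound \<open>k2\<close> gives j + k - 1 \<ge> 2 m - j, which is at least 2 m as j \<le>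
        0.\<close>
      have "(1 - p) * m \<le> (2 * (1 - c)) * m"
        using c True by (intro mult_right_mono) auto
      also have "\<dots> = (1 - c) * (2 * of_int m)" by simp
      also have "\<dots> \<le> (1 - c) * (of_int j + of_int k - 1)"
        using c1 k2 False by (intro mult_left_mono) linarith+
      finally show False using e2 by linarith
    next
      case m: False
      \<comment> \<open>Since \<open>m\<close> is nonpositive, p < c now suffices to replace 1 - p
        by 1 - c. This leaves j + k - 1 < m: with \<open>k2\<close> it yields m < j, with k \<ge> 1
        it yields j < m.\<close>
      have "(1 - p) * m \<le> (1 - c) * m"
        using p m by (intro mult_right_mono_neg) auto
      then have "(1 - c) * (of_int j + of_int k - 1) < (1 - c) * m" using e2 by linarith
      then have "of_int j + of_int k - 1 < (of_int m :: real)" using c1 by simp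
      then show False using k2 k False by linarith
    qed
  qed
qed

lemma mem_P_iff:
  assumes d: "0 < delta (b1, b2)"
  shows "((x1, x2), x3) \<in> P (b1, b2) \<longleftrightarrow> 0 \<le> x3 \<and>
    (- b1) * x1 + (b1 - b2) * x2 - (b1 - b2) * x3 \<le> delta (b1, b2) \<and>
    (- b1 - 1) * x1 + (b1 - b2) * x2 \<le> delta (b1, b2) \<and>
    (- b1) * x1 + (b1 - b2 - 1) * x2 + (2 - b1 + 2 * b2) / 2 * x3 \<le> delta (b1, b2)"
proof -
  let ?d = "delta (b1, b2)"
  have scale: "u / ?d * x1 + v / ?d * x2 + w / ?d * x3 \<le> 1 \<longleftrightarrow> u * x1 + v * x2 + w * x3 \<le> ?d"
    for u v w
  proof -
    have "u / ?d * x1 + v / ?d * x2 + w / ?d * x3 = (u * x1 + v * x2 + w * x3) / ?d"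
      by (simp add: add_divide_distrib)
    then show ?thesis using d by (simp only: divide_le_eq_1_pos)
  qed
  show ?thesis
    using scale[of "- b1" "b1 - b2" "- (b1 - b2)"] scale[of "- b1 - 1" "b1 - b2" 0]
      scale[of "- b1" "b1 - b2 - 1" "(2 - b1 + 2 * b2) / 2"]
    by (simp add: P_def Let_def del: minus_diff_eq)
qed

text \<open>The interior of a set inside a closed half-space lies in the open half-space, provided
  the normal is nonzero; the assumptions on \<open>b1\<close> and \<open>b2\<close> ensure this for
  each constraint.\<close>

lemma interior_P_strict:
  assumes x: "((x1, x2), x3) \<in> interior (P (b1, b2))"
    and b: "b1 \<noteq> 0" "b1 \<noteq> b2" and d: "0 < delta (b1, b2)"
  shows "0 < x3"
    and "(- b1) * x1 + (b1 - b2) * x2 - (b1 - b2) * x3 < delta (b1, b2)"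
    and "(- b1 - 1) * x1 + (b1 - b2) * x2 < delta (b1, b2)"
    and "(- b1) * x1 + (b1 - b2 - 1) * x2 + (2 - b1 + 2 * b2) / 2 * x3 < delta (b1, b2)"
proof -
  let ?d = "delta (b1, b2)"
  have strict: "u * x1 + v * x2 + w * x3 < r"
    if "\<And>y1 y2 y3. ((y1, y2), y3) \<in> P (b1, b2) \<Longrightarrow> u * y1 + v * y2 + w * y3 \<le> r"
      and nz: "u \<noteq> 0 \<or> v \<noteq> 0 \<or> w \<noteq> 0" for u v w r
  proof -
    have "P (b1, b2) \<subseteq> {y. ((u, v), w) \<bullet> y \<le> r}"
      using that(1) by auto
    moreover have "((u, v), w) \<noteq> 0" using nz by (simp add: zero_prod_def)
    ultimately have "((u, v), w) \<bullet> ((x1, x2), x3) < r"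
      using interior_mono interior_halfspace_le x by blast
    then show ?thesis by simp
  qed
  show "0 < x3"
    using strict[of 0 0 "-1" 0] d by (simp add: mem_P_iff)
  show "(- b1) * x1 + (b1 - b2) * x2 - (b1 - b2) * x3 < ?d"
    using strict[of "- b1" "b1 - b2" "- (b1 - b2)" ?d] b d by (simp add: mem_P_iff del: minus_diff_eq)
  show "(- b1 - 1) * x1 + (b1 - b2) * x2 < ?d"
    using strict[of "- b1 - 1" "b1 - b2" 0 ?d] d b by (simp add: mem_P_iff)
  show "(- b1) * x1 + (b1 - b2 - 1) * x2 + (2 - b1 + 2 * b2) / 2 * x3 < ?d"
    using strict[of "- b1" "b1 - b2 - 1" "(2 - b1 + 2 * b2) / 2" ?d] b d
    by (simp add: mem_P_iff)
qed

theorem proposition4p3: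
  fixes b :: "real \<times> real" and S :: "(real \<times> real) set"
  assumes "b \<in> interior (convex hull {(0, -1), (0, -1/2), (-1, -1)})"
    and "S = shifted_lattice b"
  shows "set_free (S \<times> \<int>) (P b)"
proof -
  obtain b1 b2 where b: "b = (b1, b2)" by fastforce
  have r: "-1 < b2" "b2 < b1" "b1 < 0" "b1 - 2 * b2 > 1"
    using assms(1) unfolding b type3_params_iff by auto
  have d: "0 < delta (b1, b2)" using delta_pos[OF assms(1)] b by simp
  have False if x: "x \<in> interior (P b)" "x \<in> S \<times> \<int>" for x
  proof -
    obtain m n k :: int where "x = ((of_int m + b1, of_int n + b2), of_int k)"
      using x(2) unfolding assms(2) b shifted_lattice_def by (auto elim!: Ints_cases)
    then have "((of_int m + b1, of_int n + b2), of_int k) \<in> interior (P (b1, b2))"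
      using x(1) b by simp
    note s = interior_P_strict[OF this _ _ d, unfolded delta_def prod.case]
    \<comment> \<open>At height 0 the three bounding lines of \<open>T b\<close> pass through b +
      (1, 1), b + (0, 1) and b. Measuring from these points cancels \<open>delta\<close>, whence the
      offsets in the three inequalities. In terms of b, p < c reads -1 < b2 and 2 c < 1 + p reads b1
      - 2 b2 > 1.\<close>
    show False
    proof (rule no_integer_solution[of "- b1" "1 - b1 + b2" k m "n - k"])
      show "- b1 * (of_int m - 1) + (1 - (1 - b1 + b2)) * (of_int (n - k) - 1) < 0"
        using r s(2) by (simp add: algebra_simps power2_eq_square)
      show "(1 - (1 - b1 + b2)) * (of_int (n - k) + of_int k - 1) < (1 - - b1) * of_int m"
        using r s(3) by (simp add: algebra_simps power2_eq_square)
      show "- b1 * (of_int m - of_int k / 2) < (1 - b1 + b2) * of_int (n - k)"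
        using r s(4) by (simp add: algebra_simps power2_eq_square add_divide_distrib diff_divide_distrib)
    qed (use r s(1) in auto)
  qed
  then show ?thesis unfolding set_free_def by blast
qed

end
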